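(* Let $M\subset\mathbb{C}$ be a connected, simply connected domain and let $L=1+\mathrm{i}e_1\in\mathbb{H}_{\mathbb{C}}$. Let $A,B\colon M\to\operatorname{Sp}(1,\mathbb{C})$ be holomorphic, let $X=\operatorname{Re}\int ALB\,\mathrm{d}z\colon M\to\mathbb{R}^4$ be the associated conformal minimal immersion, and set $\alpha=A^cA'$, $\beta=B'B^c$, which take values in the pure complex quaternions; write $\alpha=\alpha_1e_1+\alpha_2e_2+\alpha_3e_3$ and $\beta=\beta_1e_1+\beta_2e_2+\beta_3e_3$. Then $X$ is superminimal if and only if $$(\alpha_2+\mathrm{i}\alpha_3)(\beta_2-\mathrm{i}\beta_3)=0 \quad\text{on } M.$$ Since $M$ is connected, this is equivalent to at least one of $$\alpha_2+\mathrm{i}\alpha_3\equiv 0,\qquad \beta_2-\mathrm{i}\beta_3\equiv 0.$$ If $X$ is superminimal and non-planar, exactly one of these two alternatives holds.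
   Context: $\mathbb{H}_{\mathbb{C}}:=\mathbb{H}\otimes_{\mathbb{R}}\mathbb{C}$ is the algebra of complex quaternions: elements $q=q_0+q_1e_1+q_2e_2+q_3e_3$ with $q_j\in\mathbb{C}$, where the imaginary unit $\mathrm{i}\in\mathbb{C}$ commutes with $e_1,e_2,e_3$, and $e_1^2=e_2^2=e_3^2=-1$, $e_1e_2=e_3=-e_2e_1$, $e_2e_3=e_1=-e_3e_2$, $e_3e_1=e_2=-e_1e_3$. The conjugate is $q^c:=q_0-q_1e_1-q_2e_2-q_3e_3$ and the symmetrised norm is $q^s:=qq^c=q_0^2+q_1^2+q_2^2+q_3^2$. $\operatorname{Sp}(1,\mathbb{C}):=\{q\in\mathbb{H}_{\mathbb{C}}: q^s=1\}$. Pure complex quaternions are those with $q_0=0$. Prime denotes $\mathrm{d}/\mathrm{d}z$. $\mathbb{H}_{\mathbb{C}}$ is identified with $\mathbb{C}^4$ via $q\leftrightarrow(q_0,q_1,q_2,q_3)$; $\operatorname{Re}$ is the componentwise real part $\mathbb{C}^4\to\mathbb{R}^4$, and $\int\Phi\,\mathrm{d}z$ denotes a holomorphic primitive of $\Phi$ on $M$ (determined up to an additive constant). With $z=u+\mathrm{i}v$, an immersion $X\colon M\to\mathbb{R}^4$ is conformal if $|X_u|^2=|X_v|^2=:e^{2\omega}$ and $\langle X_u,X_v\rangle=0$; it is minimal if moreover $X_{uu}+X_{vv}=0$ (equivalently the mean curvature vector vanishes). With $(\cdot)^\perp$ the orthogonal projection to the normal plane, put $\xi=\tfrac12e^{-2\omega}(X_{uu}-X_{vv})^\perp$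 and $\eta=e^{-2\omega}(X_{uv})^\perp$. The curvature ellipse at a point is the image of the unit tangent circle under $w\mapsto\mathrm{II}(w,w)$, with $\mathrm{II}$ the second fundamental form; it is $\{\mathbf H+\xi\cos2\theta+\eta\sin2\theta\}$, where $\mathbf H$ is the mean curvature vector, and is called a circle (possibly degenerate to a point) iff $\langle\xi,\eta\rangle=0$ and $|\xi|=|\eta|$. A conformal immersion is superminimal if it is minimal and its curvature ellipse is a circle at every point. $X$ is planar if its image lies in a real affine two-plane of $\mathbb{R}^4$, and non-planar otherwise. *)

theory Defs
  imports "HOL-Complex_Analysis.Complex_Analysis"
begin

section \<open>Complex quaternions\<close>

datatype cquat = CQuat (cq0: complex) (cq1: complex) (cq2: complex) (cq3: complex)

lemma cquat_eq_iff: "p = q \<longleftrightarrow> cq0 p = cq0 q \<and> cq1 p = cq1 q \<and> cq2 p = cq2 q \<and> cq3 p = cq3 q"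
  by (auto intro: cquat.expand)

instantiation cquat :: ring_1
begin

definition "0 = CQuat 0 0 0 0"
definition "1 = CQuat 1 0 0 0"
definition "- p = CQuat (- cq0 p) (- cq1 p) (- cq2 p) (- cq3 p)"
definition "p + q = CQuat (cq0 p + cq0 q) (cq1 p + cq1 q) (cq2 p + cq2 q) (cq3 p + cq3 q)"
definition "p - q = CQuat (cq0 p - cq0 q) (cq1 p - cq1 q) (cq2 p - cq2 q) (cq3 p - cq3 q)"
definition "p * q = CQuat
  (cq0 p * cq0 q - cq1 p * cq1 q - cq2 p * cq2 q - cq3 p * cq3 q)
  (cq0 p * cq1 q + cq1 p * cq0 q + cq2 p * cq3 q - cq3 p * cq2 q)
  (cq0 p * cq2 q - cq1 p * cq3 q + cq2 p * cq0 q + cq3 p * cq1 q)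
  (cq0 p * cq3 q + cq1 p * cq2 q - cq2 p * cq1 q + cq3 p * cq0 q)"

instance
  by standard
    (simp_all add: cquat_eq_iff zero_cquat_def one_cquat_def uminus_cquat_def
      plus_cquat_def minus_cquat_def times_cquat_def algebra_simps)

end

definition cq_of_complex :: "complex \<Rightarrow> cquat" where
  "cq_of_complex c = CQuat c 0 0 0"

definition e1 :: cquat where "e1 = CQuat 0 1 0 0"
definition e2 :: cquat where "e2 = CQuat 0 0 1 0"
definition e3 :: cquat where "e3 = CQuat 0 0 0 1"

lemma cquat_basis_mult:
  "e1 * e1 = -1" "e2 * e2 = -1" "e3 * e3 = -1"
  "e1 * e2 = e3" "e2 * e1 = - e3"
  "e2 * e3 = e1" "e3 * e2 = - e1"
  "e3 * e1 = e2" "e1 * e3 = - e2"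
  by (simp_all add: e1_def e2_def e3_def times_cquat_def one_cquat_def uminus_cquat_def)

lemma cq_of_complex_commute: "cq_of_complex c * q = q * cq_of_complex c"
  by (simp add: cq_of_complex_def times_cquat_def mult.commute)

lemma cquat_expand:
  "q = cq_of_complex (cq0 q) + cq_of_complex (cq1 q) * e1
     + cq_of_complex (cq2 q) * e2 + cq_of_complex (cq3 q) * e3"
  by (simp add: cquat_eq_iff cq_of_complex_def e1_def e2_def e3_def times_cquat_def plus_cquat_def)

definition cq_conj :: "cquat \<Rightarrow> cquat" where
  "cq_conj q = CQuat (cq0 q) (- cq1 q) (- cq2 q) (- cq3 q)"

definition cq_symnorm :: "cquat \<Rightarrow> cquat" where
  "cq_symnorm q = q * cq_conj q"

lemma cq_symnorm_eq:
  "cq_symnorm q = cq_of_complex ((cq0 q)\<^sup>2 + (cq1 q)\<^sup>2 + (cq2 q)\<^sup>2 + (cq3 q)\<^sup>2)"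
  by (simp add: cq_symnorm_def cq_conj_def cq_of_complex_def times_cquat_def power2_eq_square)

definition Sp1C :: "cquat set" where
  "Sp1C = {q. cq_symnorm q = 1}"

definition cq_pure :: "cquat \<Rightarrow> bool" where
  "cq_pure q \<longleftrightarrow> cq0 q = 0"

definition cqL :: cquat where
  "cqL = 1 + cq_of_complex \<i> * e1"

definition cq_Re :: "cquat \<Rightarrow> real ^ 4" where
  "cq_Re q = vector [Re (cq0 q), Re (cq1 q), Re (cq2 q), Re (cq3 q)]"


section \<open>Holomorphic maps into the complex quaternions\<close>

definition cq_holomorphic_on :: "(complex \<Rightarrow> cquat) \<Rightarrow> complex set \<Rightarrow> bool" where
  "cq_holomorphic_on f M \<longleftrightarrow>
     (\<lambda>z. cq0 (f z)) holomorphic_on M \<and> (\<lambda>z. cq1 (f z)) holomorphic_on M \<and>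
     (\<lambda>z. cq2 (f z)) holomorphic_on M \<and> (\<lambda>z. cq3 (f z)) holomorphic_on M"

definition cq_deriv :: "(complex \<Rightarrow> cquat) \<Rightarrow> complex \<Rightarrow> cquat" where
  "cq_deriv f z = CQuat
     (deriv (\<lambda>w. cq0 (f w)) z) (deriv (\<lambda>w. cq1 (f w)) z)
     (deriv (\<lambda>w. cq2 (f w)) z) (deriv (\<lambda>w. cq3 (f w)) z)"

definition cq_primitive_on :: "complex set \<Rightarrow> (complex \<Rightarrow> cquat) \<Rightarrow> (complex \<Rightarrow> cquat) \<Rightarrow> bool" where
  "cq_primitive_on M \<Phi> F \<longleftrightarrow> cq_holomorphic_on F M \<and> (\<forall>z\<in>M. cq_deriv F z = \<Phi> z)"

lemma cq_primitive_exists: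
  assumes "open M" "simply_connected M" "cq_holomorphic_on \<Phi> M"
  shows "\<exists>F. cq_primitive_on M \<Phi> F"
proof -
  have prim: "\<exists>h. \<forall>z\<in>M. (h has_field_derivative f z) (at z)" if "f holomorphic_on M" for f
    using simply_connected_eq_global_primitive[OF assms(1)] assms(2) that by blast
  obtain f0 f1 f2 f3 where
    f: "\<forall>z\<in>M. (f0 has_field_derivative cq0 (\<Phi> z)) (at z)"
       "\<forall>z\<in>M. (f1 has_field_derivative cq1 (\<Phi> z)) (at z)"
       "\<forall>z\<in>M. (f2 has_field_derivative cq2 (\<Phi> z)) (at z)"
       "\<forall>z\<in>M. (f3 has_field_derivative cq3 (\<Phi> z)) (at z)"
    using assms(3) prim unfolding cq_holomorphic_on_def by metis
  have "cq_primitive_on M \<Phi> (\<lambda>z. CQuat (f0 z) (f1 z) (f2 z) (f3 z))"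
    unfolding cq_primitive_on_def cq_holomorphic_on_def cq_deriv_def cquat_eq_iff cquat.sel
      holomorphic_on_open[OF assms(1)]
    using f DERIV_imp_deriv by blast
  then show ?thesis by blast
qed


section \<open>Conformal, minimal and superminimal immersions of plane domains\<close>

text \<open>Partial derivatives with respect to \<open>z = u + \<i> v\<close>.\<close>

definition pdu :: "(complex \<Rightarrow> real ^ 4) \<Rightarrow> complex \<Rightarrow> real ^ 4" where
  "pdu X z = frechet_derivative X (at z) 1"

definition pdv :: "(complex \<Rightarrow> real ^ 4) \<Rightarrow> complex \<Rightarrow> real ^ 4" where
  "pdv X z = frechet_derivative X (at z) \<i>"

primrec Ck_on :: "nat \<Rightarrow> complex set \<Rightarrow> (complex \<Rightarrow> real ^ 4) \<Rightarrow> bool" where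
  "Ck_on 0 M X \<longleftrightarrow> continuous_on M X"
| "Ck_on (Suc k) M X \<longleftrightarrow>
     (\<forall>z\<in>M. X differentiable (at z)) \<and> Ck_on k M (pdu X) \<and> Ck_on k M (pdv X)"

definition immersion_on :: "complex set \<Rightarrow> (complex \<Rightarrow> real ^ 4) \<Rightarrow> bool" where
  "immersion_on M X \<longleftrightarrow>
     (\<forall>k. Ck_on k M X) \<and> (\<forall>z\<in>M. inj (frechet_derivative X (at z)))"

definition conformal_immersion_on :: "complex set \<Rightarrow> (complex \<Rightarrow> real ^ 4) \<Rightarrow> bool" where
  "conformal_immersion_on M X \<longleftrightarrow> immersion_on M X \<and>
     (\<forall>z\<in>M. (norm (pdu X z))\<^sup>2 = (norm (pdv X z))\<^sup>2 \<and> pdu X z \<bullet> pdv X z = 0)"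

definition conformal_minimal_immersion_on :: "complex set \<Rightarrow> (complex \<Rightarrow> real ^ 4) \<Rightarrow> bool" where
  "conformal_minimal_immersion_on M X \<longleftrightarrow> conformal_immersion_on M X \<and>
     (\<forall>z\<in>M. pdu (pdu X) z + pdv (pdv X) z = 0)"

text \<open>The factor \<open>e\<^sup>2\<^sup>\<omega> = |X\<^sub>u|\<^sup>2 = |X\<^sub>v|\<^sup>2\<close> of the induced metric of a conformal immersion.\<close>

definition conf_factor :: "(complex \<Rightarrow> real ^ 4) \<Rightarrow> complex \<Rightarrow> real" where
  "conf_factor X z = (norm (pdu X z))\<^sup>2"

text \<open>Orthogonal projection of \<open>w\<close> to the normal plane of \<open>X\<close> at \<open>z\<close>; the vector exists and is
  unique by \<open>orthogonal_subspace_decomp_exists\<close> and \<open>orthogonal_subspace_decomp_unique\<close>.\<close>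

definition normal_part :: "(complex \<Rightarrow> real ^ 4) \<Rightarrow> complex \<Rightarrow> real ^ 4 \<Rightarrow> real ^ 4" where
  "normal_part X z w =
     (THE n. n \<in> (span {pdu X z, pdv X z})\<^sup>\<bottom> \<and> w - n \<in> span {pdu X z, pdv X z})"

definition ell_xi :: "(complex \<Rightarrow> real ^ 4) \<Rightarrow> complex \<Rightarrow> real ^ 4" where
  "ell_xi X z =
     (1 / (2 * conf_factor X z)) *\<^sub>R normal_part X z (pdu (pdu X) z - pdv (pdv X) z)"

definition ell_eta :: "(complex \<Rightarrow> real ^ 4) \<Rightarrow> complex \<Rightarrow> real ^ 4" where
  "ell_eta X z = (1 / conf_factor X z) *\<^sub>R normal_part X z (pdv (pdu X) z)"

text \<open>For a conformal immersion the unit tangent vectors at \<open>z\<close> are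
  \<open>e\<^sup>-\<^sup>\<omega> (cos \<theta> X\<^sub>u + sin \<theta> X\<^sub>v)\<close>, so the curvature ellipse
  \<open>{II(w,w). |w| = 1}\<close> is \<open>{H + cos 2\<theta> \<xi> + sin 2\<theta> \<eta>}\<close> with \<open>\<xi>\<close>, \<open>\<eta>\<close> as above and \<open>H\<close> the mean
  curvature vector. The circle may degenerate to a point.\<close>

definition curvature_ellipse_circle :: "(complex \<Rightarrow> real ^ 4) \<Rightarrow> complex \<Rightarrow> bool" where
  "curvature_ellipse_circle X z \<longleftrightarrow>
     ell_xi X z \<bullet> ell_eta X z = 0 \<and> norm (ell_xi X z) = norm (ell_eta X z)"

definition superminimal_on :: "complex set \<Rightarrow> (complex \<Rightarrow> real ^ 4) \<Rightarrow> bool" where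
  "superminimal_on M X \<longleftrightarrow>
     conformal_minimal_immersion_on M X \<and> (\<forall>z\<in>M. curvature_ellipse_circle X z)"

definition planar_on :: "complex set \<Rightarrow> (complex \<Rightarrow> real ^ 4) \<Rightarrow> bool" where
  "planar_on M X \<longleftrightarrow> (\<exists>P. affine P \<and> aff_dim P = 2 \<and> X ` M \<subseteq> P)"

end

theory Submission
  imports Defs
begin

text \<open>Write \<open>\<Phi> = A L B\<close>. The symmetrised norm is multiplicative and \<open>L\<close> is null, so \<open>\<Phi> \<cdot> \<Phi> = 0\<close> for the
  complex bilinear form and \<open>X\<close> is conformal and minimal. The normal component of \<open>\<Phi>'\<close> is
  \<open>\<Phi>' - \<lambda> \<Phi>\<close>, whose bilinear square is \<open>\<Phi>' \<cdot> \<Phi>'\<close>, so the curvature ellipse is a circle iff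
  \<open>\<Phi>' \<cdot> \<Phi>' = 0\<close>. Since \<open>\<Phi>' = A (\<alpha> L + L \<beta>) B\<close>, invariance of the form under \<open>Sp(1,\<complex>)\<close> gives
  \<open>\<Phi>' \<cdot> \<Phi>' = 4 (\<alpha>\<^sub>2 + \<i> \<alpha>\<^sub>3) (\<beta>\<^sub>2 - \<i> \<beta>\<^sub>3)\<close>. If both factors vanish identically, then
  \<open>\<alpha> L + L \<beta>\<close> is a multiple of \<open>L\<close>, so \<open>\<Phi>' = m \<Phi>\<close> with \<open>m\<close> holomorphic; hence \<open>\<Phi>\<close> stays in a fixed
  complex line and \<open>X\<close> is planar.\<close>

lemmas cquat_defs = zero_cquat_def one_cquat_def uminus_cquat_def plus_cquat_def
  minus_cquat_def times_cquat_def cq_of_complex_def cq_conj_def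

subsection \<open>The complex bilinear form\<close>

text \<open>This is the polarisation of the symmetrised norm. It is bilinear rather than Hermitian,
  so nonzero null vectors exist. Written as the scalar part of a product, it inherits the cyclicity
  of \<open>cq0\<close>.\<close>

definition cq_dot :: "cquat \<Rightarrow> cquat \<Rightarrow> complex" where
  "cq_dot p q = cq0 (p * cq_conj q)"

lemma cq_dot_expand:
  "cq_dot p q = cq0 p * cq0 q + cq1 p * cq1 q + cq2 p * cq2 q + cq3 p * cq3 q"
  by (simp add: cq_dot_def cquat_defs)

lemma cq_conj_mult: "cq_conj (p * q) = cq_conj q * cq_conj p"
  by (simp add: cquat_defs algebra_simps)

lemma cq0_mult_commute: "cq0 (p * q) = cq0 (q * p)"
  by (simp add: cquat_defs algebra_simps)

lemma Sp1C_conj_right: "a \<in> Sp1C \<Longrightarrow> a * cq_conj a = 1"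
  by (simp add: Sp1C_def cq_symnorm_def)

lemma Sp1C_conj_left: "a \<in> Sp1C \<Longrightarrow> cq_conj a * a = 1"
  by (auto simp: Sp1C_def cq_symnorm_def cquat_defs algebra_simps)

text \<open>The factor \<open>b\<close> cancels against its conjugate in the middle of the product,
  and cyclicity of \<open>cq0\<close> brings \<open>cq_conj a\<close> next to
  \<open>a\<close>.\<close>

lemma cq_dot_Sp1C_invariant:
  assumes a: "a \<in> Sp1C" and b: "b \<in> Sp1C"
  shows "cq_dot (a * p * b) (a * q * b) = cq_dot p q"
proof -
  have "a * p * b * cq_conj (a * q * b) = a * p * (b * cq_conj b) * cq_conj q * cq_conj a"
    by (simp add: cq_conj_mult mult.assoc)
  then have "cq_dot (a * p * b) (a * q * b) = cq0 (a * (p * cq_conj q * cq_conj a))"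
    by (simp add: cq_dot_def Sp1C_conj_right[OF b] mult.assoc)
  also have "\<dots> = cq0 (p * cq_conj q * (cq_conj a * a))"
    by (subst cq0_mult_commute) (simp add: mult.assoc)
  finally show ?thesis
    by (simp add: Sp1C_conj_left[OF a] cq_dot_def)
qed

lemma Sp1C_sandwich_eq_0_iff:
  assumes a: "a \<in> Sp1C" and b: "b \<in> Sp1C"
  shows "a * p * b = 0 \<longleftrightarrow> p = 0"
proof
  assume "a * p * b = 0"
  then have "(cq_conj a * a) * p * (b * cq_conj b) = 0"
    by (metis mult.assoc mult_zero_left mult_zero_right)
  then show "p = 0"
    by (simp add: Sp1C_conj_left[OF a] Sp1C_conj_right[OF b])
qed simp

lemma cqL_nonzero: "cqL \<noteq> 0"
  by (simp add: cqL_def e1_def cquat_defs)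

lemma cq_dot_cqL: "cq_dot cqL cqL = 0"
  by (simp add: cqL_def e1_def cq_dot_expand cquat_defs)

text \<open>Conceptually, both terms die because \<open>cqL\<close> times its conjugate, in either
  order, is 0. Sandwiched between \<open>A\<close> and \<open>B\<close>, this yields F' . F'' =
  0.\<close>

lemma cq_dot_cqL_pure:
  assumes "cq_pure a" "cq_pure b"
  shows "cq_dot cqL (a * cqL + cqL * b) = 0"
  using assms by (simp add: cqL_def e1_def cq_dot_expand cquat_defs cq_pure_def algebra_simps)

text \<open>Splitting off multiples of L gives a L = -i a1 L + (a2 + i a3)(e2 - i e3) and L b = -i
  b1 L + (b2 - i b3)(e2 + i e3). L is null and orthogonal to the null vectors e2 - i e3 and e2 + i
  e3, whose mutual product is 2. The cross term occurs twice, hence the 4.\<close>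

lemma cq_dot_self_pure_cqL:
  assumes "cq_pure a" "cq_pure b"
  shows "cq_dot (a * cqL + cqL * b) (a * cqL + cqL * b)
    = 4 * ((cq2 a + \<i> * cq3 a) * (cq2 b - \<i> * cq3 b))"
  using assms by (simp add: cqL_def e1_def cq_dot_expand cquat_defs cq_pure_def algebra_simps)

text \<open>In the splitting just described, only the multiples of L survive.\<close>

lemma pure_cqL_proportional:
  assumes "cq_pure a" "cq_pure b" "cq2 a + \<i> * cq3 a = 0" "cq2 b - \<i> * cq3 b = 0"
  shows "a * cqL + cqL * b = cq_of_complex (- \<i> * (cq1 a + cq1 b)) * cqL"
proof -
  have "cq2 a = - (\<i> * cq3 a)" "cq2 b = \<i> * cq3 b"
    using assms(3,4) by (auto simp: add_eq_0_iff2)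
  with assms(1,2) show ?thesis
    by (simp add: cqL_def e1_def cquat_defs cq_pure_def algebra_simps)
qed


subsection \<open>Real parts\<close>

lemma cq_Re_nth [simp]:
  "cq_Re q $ 1 = Re (cq0 q)" "cq_Re q $ 2 = Re (cq1 q)"
  "cq_Re q $ 3 = Re (cq2 q)" "cq_Re q $ 4 = Re (cq3 q)"
  by (simp_all add: cq_Re_def vector_def)

lemma cq_Re_add: "cq_Re (p + q) = cq_Re p + cq_Re q"
  by (simp add: vec_eq_iff forall_4 cquat_defs)

lemma cq_Re_minus: "cq_Re (- p) = - cq_Re p"
  by (simp add: vec_eq_iff forall_4 cquat_defs)

lemma cq_Re_complex_scale:
  "cq_Re (cq_of_complex h * q) = Re h *\<^sub>R cq_Re q + Im h *\<^sub>R cq_Re (cq_of_complex \<i> * q)"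
  by (simp add: vec_eq_iff forall_4 cquat_defs)

lemma cq_of_complex_ii_twice: "cq_of_complex \<i> * (cq_of_complex \<i> * q) = - q"
  by (simp add: cquat_defs)

text \<open>The signs come from \<open>cq_Re (cq_of_complex \<i> * p)\<close> being minus the
  imaginary part of \<open>p\<close>.\<close>

lemma cq_dot_eq_inner:
  "cq_dot p q = Complex
     (cq_Re p \<bullet> cq_Re q - cq_Re (cq_of_complex \<i> * p) \<bullet> cq_Re (cq_of_complex \<i> * q))
     (- (cq_Re p \<bullet> cq_Re (cq_of_complex \<i> * q)) - cq_Re (cq_of_complex \<i> * p) \<bullet> cq_Re q)"
  by (simp add: complex_eq_iff inner_vec_def sum_4 cq_dot_expand cquat_defs)

lemma cq_dot_self_eq_0_iff:
  "cq_dot p p = 0 \<longleftrightarrow>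
     (norm (cq_Re p))\<^sup>2 = (norm (cq_Re (cq_of_complex \<i> * p)))\<^sup>2 \<and>
     cq_Re p \<bullet> cq_Re (cq_of_complex \<i> * p) = 0"
  by (auto simp: cq_dot_eq_inner complex_eq_iff power2_norm_eq_inner inner_commute)

text \<open>Nullity makes the two real vectors equally long, so if one vanished both would, forcing
  \<open>p = 0\<close>.\<close>

lemma null_cq_Re_nonzero:
  assumes "cq_dot p p = 0" "p \<noteq> 0"
  shows "cq_Re p \<noteq> 0" "cq_Re (cq_of_complex \<i> * p) \<noteq> 0"
proof -
  have eq: "norm (cq_Re p) = norm (cq_Re (cq_of_complex \<i> * p))"
    using assms(1) by (simp add: cq_dot_self_eq_0_iff)
  have "\<not> (cq_Re p = 0 \<and> cq_Re (cq_of_complex \<i> * p) = 0)"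
    using assms(2) by (auto simp: vec_eq_iff forall_4 cquat_defs cquat_eq_iff complex_eq_iff)
  with eq show "cq_Re p \<noteq> 0" "cq_Re (cq_of_complex \<i> * p) \<noteq> 0"
    by auto
qed


subsection \<open>Derivatives of quaternion-valued maps\<close>

text \<open>Since \<open>deriv\<close> is total, \<open>cq_deriv\<close> alone does not record
  differentiability; this relation does, so that product rules compose.\<close>

definition cq_has_deriv :: "(complex \<Rightarrow> cquat) \<Rightarrow> cquat \<Rightarrow> complex \<Rightarrow> bool" where
  "cq_has_deriv f d z \<longleftrightarrow>
     ((\<lambda>w. cq0 (f w)) has_field_derivative cq0 d) (at z) \<and>
     ((\<lambda>w. cq1 (f w)) has_field_derivative cq1 d) (at z) \<and>
     ((\<lambda>w. cq2 (f w)) has_field_derivative cq2 d) (at z) \<and>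
     ((\<lambda>w. cq3 (f w)) has_field_derivative cq3 d) (at z)"

lemma cq_has_deriv_imp_deriv: "cq_has_deriv f d z \<Longrightarrow> cq_deriv f z = d"
  by (auto simp: cq_has_deriv_def cq_deriv_def cquat_eq_iff intro: DERIV_imp_deriv)

lemma cq_holomorphic_has_deriv:
  assumes "open M" "z \<in> M" "cq_holomorphic_on f M"
  shows "cq_has_deriv f (cq_deriv f z) z"
  using assms holomorphic_derivI
  unfolding cq_has_deriv_def cq_deriv_def cq_holomorphic_on_def cquat.sel by blast

lemma cq_has_deriv_mult:
  assumes "cq_has_deriv f d z" "cq_has_deriv g e z"
  shows "cq_has_deriv (\<lambda>w. f w * g w) (d * g z + f z * e) z"
  using assms unfolding cq_has_deriv_def times_cquat_def plus_cquat_def cquat.sel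
  by (auto intro!: derivative_eq_intros simp: algebra_simps)

lemma cq_has_deriv_const: "cq_has_deriv (\<lambda>_. c) 0 z"
  by (simp add: cq_has_deriv_def zero_cquat_def)

lemma cq_has_deriv_conj:
  "cq_has_deriv f d z \<Longrightarrow> cq_has_deriv (\<lambda>w. cq_conj (f w)) (cq_conj d) z"
  unfolding cq_has_deriv_def cq_conj_def cquat.sel by (auto intro!: derivative_intros)

lemma cq_has_deriv_transform:
  assumes "open M" "z \<in> M" "cq_has_deriv f d z" "\<And>w. w \<in> M \<Longrightarrow> f w = g w"
  shows "cq_has_deriv g d z"
  using assms(3) unfolding cq_has_deriv_def
  using assms(1,2,4) by (auto intro: has_field_derivative_transform_within_open)

lemma cq_holomorphic_deriv:
  "open M \<Longrightarrow> cq_holomorphic_on f M \<Longrightarrow> cq_holomorphic_on (cq_deriv f) M"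
  by (auto simp: cq_holomorphic_on_def cq_deriv_def intro: holomorphic_deriv)

lemma cq_holomorphic_mult:
  "cq_holomorphic_on f M \<Longrightarrow> cq_holomorphic_on g M \<Longrightarrow> cq_holomorphic_on (\<lambda>z. f z * g z) M"
  by (auto simp: cq_holomorphic_on_def times_cquat_def intro!: holomorphic_intros)

lemma cq_holomorphic_conj:
  "cq_holomorphic_on f M \<Longrightarrow> cq_holomorphic_on (\<lambda>z. cq_conj (f z)) M"
  by (auto simp: cq_holomorphic_on_def cq_conj_def intro!: holomorphic_intros)

lemma cq_holomorphic_const: "cq_holomorphic_on (\<lambda>_. c) M"
  by (simp add: cq_holomorphic_on_def)

lemma cq_deriv_scale:
  assumes "open M" "z \<in> M" "cq_holomorphic_on f M"
  shows "cq_deriv (\<lambda>w. c * f w) z = c * cq_deriv f z"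
  using cq_has_deriv_mult[OF cq_has_deriv_const cq_holomorphic_has_deriv[OF assms], of c]
  by (simp add: cq_has_deriv_imp_deriv)

text \<open>Differentiating A A^c = 1 shows that A' A^c plus its conjugate is 0, and this sum is
  twice the scalar part. Cyclicity of \<open>cq0\<close> handles the other order.\<close>

lemma Sp1C_deriv_pure:
  assumes M: "open M" "z \<in> M" and A: "cq_holomorphic_on A M" and S: "\<forall>w\<in>M. A w \<in> Sp1C"
  shows "cq_pure (cq_conj (A z) * cq_deriv A z)" "cq_pure (cq_deriv A z * cq_conj (A z))"
proof -
  note dA = cq_holomorphic_has_deriv[OF M A]
  have "cq_has_deriv (\<lambda>w. A w * cq_conj (A w))
      (cq_deriv A z * cq_conj (A z) + A z * cq_conj (cq_deriv A z)) z"
    by (intro cq_has_deriv_mult cq_has_deriv_conj dA)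
  moreover have "cq_has_deriv (\<lambda>w. A w * cq_conj (A w)) 0 z"
    using cq_has_deriv_transform[OF M cq_has_deriv_const, of 1 "\<lambda>w. A w * cq_conj (A w)"] S
    by (simp add: Sp1C_conj_right)
  ultimately have "cq_deriv A z * cq_conj (A z) + A z * cq_conj (cq_deriv A z) = 0"
    using cq_has_deriv_imp_deriv by metis
  then have "2 * cq0 (cq_deriv A z * cq_conj (A z)) = 0"
    by (simp add: cquat_defs algebra_simps)
  then show "cq_pure (cq_deriv A z * cq_conj (A z))"
    by (simp add: cq_pure_def)
  then show "cq_pure (cq_conj (A z) * cq_deriv A z)"
    by (simp add: cq_pure_def cq0_mult_commute)
qed


subsection \<open>Real parts of holomorphic maps\<close>

lemma cq_Re_has_derivative:
  assumes M: "open M" "z \<in> M" and G: "cq_holomorphic_on G M"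
    and X: "\<forall>w\<in>M. X w = cq_Re (G w)"
  shows "(X has_derivative (\<lambda>h. cq_Re (cq_of_complex h * cq_deriv G z))) (at z)"
proof -
  have G': "cq_has_deriv G (cq_deriv G z) z"
    by (rule cq_holomorphic_has_deriv[OF M G])
  have comp: "((\<lambda>w. Re (f w)) has_derivative (\<lambda>h. Re (h * d))) (at z)"
    if "(f has_field_derivative d) (at z)" for f d
    using has_derivative_Re[OF that[unfolded has_field_derivative_def]]
    by (simp add: mult.commute)
  have "((\<lambda>w. cq_Re (G w)) has_derivative (\<lambda>h. cq_Re (cq_of_complex h * cq_deriv G z))) (at z)"
  proof (subst has_derivative_componentwise_within, rule ballI)
    fix b :: "real ^ 4" assume "b \<in> Basis"
    then obtain i where b: "b = axis i 1"
      by (auto simp: Basis_vec_def)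
    have "((\<lambda>w. cq_Re (G w) $ i) has_derivative
        (\<lambda>h. cq_Re (cq_of_complex h * cq_deriv G z) $ i)) (at z)"
      using exhaust_4[of i] comp G' unfolding cq_has_deriv_def
      by (auto simp: cq_of_complex_def times_cquat_def simp del: times_complex.sel)
    then show "((\<lambda>w. cq_Re (G w) \<bullet> b) has_derivative
        (\<lambda>h. cq_Re (cq_of_complex h * cq_deriv G z) \<bullet> b)) (at z)"
      by (simp add: b inner_axis)
  qed
  then show ?thesis
    using M X by (auto intro: has_derivative_transform_within_open)
qed

lemma cq_Re_derivatives:
  assumes "open M" "z \<in> M" "cq_holomorphic_on G M" "\<forall>w\<in>M. X w = cq_Re (G w)"
  shows "frechet_derivative X (at z) = (\<lambda>h. cq_Re (cq_of_complex h * cq_deriv G z))"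
    and "pdu X z = cq_Re (cq_deriv G z)"
    and "pdv X z = cq_Re (cq_of_complex \<i> * cq_deriv G z)"
    and "X differentiable (at z)"
proof -
  note D = cq_Re_has_derivative[OF assms]
  show *: "frechet_derivative X (at z) = (\<lambda>h. cq_Re (cq_of_complex h * cq_deriv G z))"
    using frechet_derivative_at[OF D] by simp
  have "cq_of_complex 1 * cq_deriv G z = cq_deriv G z"
    by (simp add: cquat_defs)
  with * show "pdu X z = cq_Re (cq_deriv G z)"
    by (simp add: pdu_def)
  show "pdv X z = cq_Re (cq_of_complex \<i> * cq_deriv G z)"
    by (simp add: pdv_def *)
  show "X differentiable (at z)"
    using D by (auto simp: differentiable_def)
qed

text \<open>The induction varies \<open>G\<close>, because the partial derivatives of Re G are again
  real parts of holomorphic maps, namely of G' and i G'.\<close>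

lemma cq_Re_Ck_on:
  assumes M: "open M" and "cq_holomorphic_on G M" "\<forall>w\<in>M. X w = cq_Re (G w)"
  shows "Ck_on k M X"
  using assms(2,3)
proof (induction k arbitrary: X G)
  case 0
  have "\<forall>z\<in>M. X differentiable (at z)"
    using cq_Re_derivatives(4)[OF M _ 0] by blast
  then show ?case
    by (auto intro!: continuous_at_imp_continuous_on differentiable_imp_continuous_within)
next
  case (Suc k)
  note D = cq_Re_derivatives[OF M _ Suc.prems]
  have "Ck_on k M (pdu X)"
    by (rule Suc.IH[OF cq_holomorphic_deriv[OF M Suc.prems(1)]]) (simp add: D)
  moreover have "Ck_on k M (pdv X)"
    by (rule Suc.IH[OF cq_holomorphic_mult[OF cq_holomorphic_const[of "cq_of_complex \<i>"]
          cq_holomorphic_deriv[OF M Suc.prems(1)]]]) (simp add: D)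
  ultimately show ?case
    using D(4) by simp
qed

lemma cq_Re_second_derivatives:
  assumes M: "open M" "z \<in> M" and G: "cq_holomorphic_on G M"
    and X: "\<forall>w\<in>M. X w = cq_Re (G w)"
  shows "pdu (pdu X) z = cq_Re (cq_deriv (cq_deriv G) z)"
    and "pdv (pdu X) z = cq_Re (cq_of_complex \<i> * cq_deriv (cq_deriv G) z)"
    and "pdv (pdv X) z = - cq_Re (cq_deriv (cq_deriv G) z)"
proof -
  note D = cq_Re_derivatives[OF M(1) _ G X] and hol = cq_holomorphic_deriv[OF M(1) G]
  have u: "\<forall>w\<in>M. pdu X w = cq_Re (cq_deriv G w)"
    and v: "\<forall>w\<in>M. pdv X w = cq_Re (cq_of_complex \<i> * cq_deriv G w)"
    by (simp_all add: D)
  show "pdu (pdu X) z = cq_Re (cq_deriv (cq_deriv G) z)"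
    "pdv (pdu X) z = cq_Re (cq_of_complex \<i> * cq_deriv (cq_deriv G) z)"
    using cq_Re_derivatives(2,3)[OF M hol u] by simp_all
  show "pdv (pdv X) z = - cq_Re (cq_deriv (cq_deriv G) z)"
    using cq_Re_derivatives(3)[OF M cq_holomorphic_mult[OF cq_holomorphic_const hol] v]
    by (simp add: cq_deriv_scale[OF M hol] cq_of_complex_ii_twice cq_Re_minus)
qed

lemma null_conformal_minimal:
  assumes M: "open M" and G: "cq_holomorphic_on G M" and X: "\<forall>w\<in>M. X w = cq_Re (G w)"
    and null: "\<forall>z\<in>M. cq_dot (cq_deriv G z) (cq_deriv G z) = 0"
    and nz: "\<forall>z\<in>M. cq_deriv G z \<noteq> 0"
  shows "conformal_minimal_immersion_on M X"
  unfolding conformal_minimal_immersion_on_def conformal_immersion_on_def immersion_on_def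
proof (intro conjI allI ballI)
  show "Ck_on k M X" for k
    by (rule cq_Re_Ck_on[OF M G X])
  fix z assume z: "z \<in> M"
  note D = cq_Re_derivatives[OF M z G X]
  let ?p = "cq_deriv G z"
  have conf: "(norm (cq_Re ?p))\<^sup>2 = (norm (cq_Re (cq_of_complex \<i> * ?p)))\<^sup>2"
    "cq_Re ?p \<bullet> cq_Re (cq_of_complex \<i> * ?p) = 0"
    "cq_Re (cq_of_complex \<i> * ?p) \<bullet> cq_Re ?p = 0"
    using null z by (auto simp: cq_dot_self_eq_0_iff inner_commute)
  then show "(norm (pdu X z))\<^sup>2 = (norm (pdv X z))\<^sup>2" "pdu X z \<bullet> pdv X z = 0"
    by (simp_all add: D)
  show "pdu (pdu X) z + pdv (pdv X) z = 0"
    by (simp add: cq_Re_second_derivatives[OF M z G X])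
  show "inj (frechet_derivative X (at z))"
  proof (rule linear_injective_0[THEN iffD2])
    show "linear (frechet_derivative X (at z))"
      using D(4) by (rule linear_frechet_derivative)
    show "\<forall>h. frechet_derivative X (at z) h = 0 \<longrightarrow> h = 0"
    proof (intro allI impI)
      fix h assume "frechet_derivative X (at z) h = 0"
      then have 0: "Re h *\<^sub>R cq_Re ?p + Im h *\<^sub>R cq_Re (cq_of_complex \<i> * ?p) = 0"
        by (simp add: D(1) flip: cq_Re_complex_scale)
      \<comment> \<open>Pairing with each of the orthogonal nonzero vectors \<open>X_u\<close> and
        \<open>X_v\<close> isolates one coordinate of \<open>h\<close>.\<close>
      have "Re h * (cq_Re ?p \<bullet> cq_Re ?p) = 0"
        using arg_cong[OF 0, of "\<lambda>x. x \<bullet> cq_Re ?p"] conf(2,3)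
        by (simp add: inner_add_left)
      moreover have "Im h * (cq_Re (cq_of_complex \<i> * ?p) \<bullet> cq_Re (cq_of_complex \<i> * ?p)) = 0"
        using arg_cong[OF 0, of "\<lambda>x. x \<bullet> cq_Re (cq_of_complex \<i> * ?p)"] conf(2,3)
        by (simp add: inner_add_left)
      ultimately show "h = 0"
        using null_cq_Re_nonzero[of ?p] null nz z by (auto simp: complex_eq_iff)
    qed
  qed
qed


subsection \<open>The curvature ellipse\<close>

lemma normal_part_eq:
  assumes "pdu X z \<bullet> pdv X z = 0" "pdu X z \<bullet> pdu X z = c" "pdv X z \<bullet> pdv X z = c" "c \<noteq> 0"
  shows "normal_part X z w
    = w - (w \<bullet> pdu X z / c) *\<^sub>R pdu X z - (w \<bullet> pdv X z / c) *\<^sub>R pdv X z"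
    (is "_ = ?n")
  unfolding normal_part_def
proof (rule the_equality)
  let ?S = "span {pdu X z, pdv X z}"
  have perp: "x \<in> ?S\<^sup>\<bottom> \<longleftrightarrow> pdu X z \<bullet> x = 0 \<and> pdv X z \<bullet> x = 0" for x
  proof
    assume "x \<in> ?S\<^sup>\<bottom>"
    then show "pdu X z \<bullet> x = 0 \<and> pdv X z \<bullet> x = 0"
      by (auto simp: orthogonal_comp_def orthogonal_def span_base)
  next
    assume "pdu X z \<bullet> x = 0 \<and> pdv X z \<bullet> x = 0"
    then show "x \<in> ?S\<^sup>\<bottom>"
      by (auto simp: orthogonal_comp_def orthogonal_def span_breakdown_eq inner_left_distrib
          inner_diff_left algebra_simps)
  qed
  have "w - ?n \<in> ?S"
    by (simp add: span_add span_scale span_base)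
  moreover have "?n \<in> ?S\<^sup>\<bottom>"
    using assms by (simp add: perp inner_diff_right inner_commute)
  ultimately show n: "?n \<in> ?S\<^sup>\<bottom> \<and> w - ?n \<in> ?S"
    by blast
  \<comment> \<open>Two candidates differ by a vector lying both in the tangent plane and in its
    complement, hence orthogonal to itself.\<close>
  fix m assume m: "m \<in> ?S\<^sup>\<bottom> \<and> w - m \<in> ?S"
  have "m - ?n = (w - ?n) - (w - m)"
    by simp
  then have "m - ?n \<in> ?S"
    using m n span_diff by metis
  moreover have "m - ?n \<in> ?S\<^sup>\<bottom>"
    using m n by (simp add: perp inner_diff_right)
  ultimately have "(m - ?n) \<bullet> (m - ?n) = 0"
    unfolding orthogonal_comp_def orthogonal_def by blast
  then show "m = ?n"
    by simp
qed

text \<open>With \<open>G' = X\<^sub>u - \<i> X\<^sub>v\<close> null, \<open>\<xi> - \<i> \<eta>\<close> is a positive multiple of \<open>G'' - \<lambda> G'\<close> for some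
  \<open>\<lambda>\<close>; since \<open>G' \<cdot> G' = G' \<cdot> G'' = 0\<close>, its bilinear square is a positive multiple of \<open>G'' \<cdot> G''\<close>.\<close>

lemma null_curvature_ellipse_circle_iff:
  assumes M: "open M" "z \<in> M" and G: "cq_holomorphic_on G M" and X: "\<forall>w\<in>M. X w = cq_Re (G w)"
    and null: "cq_dot (cq_deriv G z) (cq_deriv G z) = 0"
    and nz: "cq_deriv G z \<noteq> 0"
    and orth: "cq_dot (cq_deriv G z) (cq_deriv (cq_deriv G) z) = 0"
  shows "curvature_ellipse_circle X z \<longleftrightarrow>
    cq_dot (cq_deriv (cq_deriv G) z) (cq_deriv (cq_deriv G) z) = 0"
proof -
  define a b where "a = pdu X z" and "b = pdv X z"
  define p q where "p = pdu (pdu X) z" and "q = pdv (pdu X) z"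
  define c where "c = a \<bullet> a"
  note D = cq_Re_derivatives[OF M G X] and D2 = cq_Re_second_derivatives[OF M G X]
  have ab: "a \<bullet> b = 0" "b \<bullet> a = 0" "b \<bullet> b = c"
    using null by (simp_all add: cq_dot_self_eq_0_iff D a_def b_def c_def
        power2_norm_eq_inner inner_commute)
  have c: "c > 0"
    using null_cq_Re_nonzero(1)[OF null nz] by (simp add: c_def a_def D)
  \<comment> \<open>These are the real and imaginary parts of G' . G'' = 0.\<close>
  have orth': "b \<bullet> q = a \<bullet> p" "b \<bullet> p = - (a \<bullet> q)"
    using orth by (simp_all add: cq_dot_eq_inner complex_eq_iff a_def b_def p_def q_def D D2)
  have N: "normal_part X z w = w - (w \<bullet> a / c) *\<^sub>R a - (w \<bullet> b / c) *\<^sub>R b" for w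
    unfolding a_def b_def by (rule normal_part_eq) (use ab c in \<open>simp_all add: a_def b_def c_def\<close>)
  have cf: "conf_factor X z = c"
    by (simp add: conf_factor_def c_def a_def power2_norm_eq_inner)
  \<comment> \<open>Harmonicity gives \<open>X_vv = - X_uu\<close>; the resulting 2 cancels the one
    half in the definition of \<xi>.\<close>
  have "pdu (pdu X) z - pdv (pdv X) z = 2 *\<^sub>R p"
    by (simp add: p_def D2 scaleR_2)
  then have xi: "ell_xi X z = (1 / c) *\<^sub>R (p - (p \<bullet> a / c) *\<^sub>R a - (p \<bullet> b / c) *\<^sub>R b)"
    by (simp add: ell_xi_def cf N scaleR_diff_right)
  have eta: "ell_eta X z = (1 / c) *\<^sub>R (q - (q \<bullet> a / c) *\<^sub>R a - (q \<bullet> b / c) *\<^sub>R b)"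
    by (simp add: ell_eta_def cf N q_def)
  have *: "a \<bullet> a = c" "p \<bullet> a = a \<bullet> p" "q \<bullet> a = a \<bullet> q" "p \<bullet> b = - (a \<bullet> q)" "q \<bullet> b = a \<bullet> p"
    "q \<bullet> p = p \<bullet> q"
    using orth' by (simp_all add: c_def inner_commute)
  \<comment> \<open>By \<open>orth'\<close> the tangential contributions cancel in the mixed
    product. In the two squares below they are equal, so they drop out when the norms are
    compared.\<close>
  have in_xe: "ell_xi X z \<bullet> ell_eta X z = (p \<bullet> q) / c\<^sup>2"
    using c
    unfolding xi eta inner_diff_left inner_diff_right inner_scaleR_left inner_scaleR_right ab orth' *
    by (simp add: power2_eq_square field_simps)
  have in_xx: "ell_xi X z \<bullet> ell_xi X z = (p \<bullet> p - ((a \<bullet> p)\<^sup>2 + (a \<bullet> q)\<^sup>2) / c) / c\<^sup>2"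
    using c
    unfolding xi inner_diff_left inner_diff_right inner_scaleR_left inner_scaleR_right ab orth' *
    by (simp add: power2_eq_square field_simps)
  have in_ee: "ell_eta X z \<bullet> ell_eta X z = (q \<bullet> q - ((a \<bullet> p)\<^sup>2 + (a \<bullet> q)\<^sup>2) / c) / c\<^sup>2"
    using c
    unfolding eta inner_diff_left inner_diff_right inner_scaleR_left inner_scaleR_right ab orth' *
    by (simp add: power2_eq_square field_simps)
  have "curvature_ellipse_circle X z \<longleftrightarrow> p \<bullet> q = 0 \<and> p \<bullet> p = q \<bullet> q"
    using c by (simp add: curvature_ellipse_circle_def norm_eq in_xe in_xx in_ee)
  also have "\<dots> \<longleftrightarrow> cq_dot (cq_deriv (cq_deriv G) z) (cq_deriv (cq_deriv G) z) = 0"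
    by (auto simp: cq_dot_self_eq_0_iff p_def q_def D2 power2_norm_eq_inner)
  finally show ?thesis .
qed


subsection \<open>Planarity\<close>

text \<open>Nullity makes Re c and Re(i c) orthogonal and nonzero, so the real image of the complex
  line has dimension exactly 2, as \<open>planar_on\<close> demands.\<close>

lemma affine_complex_line_planar:
  assumes null: "cq_dot c c = 0" "c \<noteq> 0"
    and X: "\<forall>z\<in>M. X z = cq_Re (d + cq_of_complex (h z) * c)"
  shows "planar_on M X"
  unfolding planar_on_def
proof (intro exI conjI)
  let ?a = "cq_Re c" and ?b = "cq_Re (cq_of_complex \<i> * c)"
  let ?P = "(\<lambda>x. cq_Re d + x) ` span {?a, ?b}"
  show "affine ?P"
    by (intro affine_translation[THEN iffD1] subspace_imp_affine subspace_span)
  have nz: "?a \<noteq> 0" "?b \<noteq> 0"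
    by (rule null_cq_Re_nonzero[OF null])+
  have orth: "?a \<bullet> ?b = 0"
    using null(1) by (simp add: cq_dot_self_eq_0_iff)
  then have ne: "?a \<noteq> ?b"
    using nz by auto
  have "independent {?a, ?b}"
    by (rule pairwise_orthogonal_independent)
      (use nz orth in \<open>auto simp: pairwise_def orthogonal_def inner_commute\<close>)
  then have "dim (span {?a, ?b}) = 2"
    using ne by (simp add: dim_span dim_eq_card_independent)
  then show "aff_dim ?P = 2"
    by (simp only: aff_dim_translation_eq aff_dim_subspace[OF subspace_span] of_nat_numeral)
  show "X ` M \<subseteq> ?P"
  proof
    fix y assume "y \<in> X ` M"
    then obtain z where "z \<in> M" "y = X z" by auto
    then have "y = cq_Re d + (Re (h z) *\<^sub>R ?a + Im (h z) *\<^sub>R ?b)"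
      using X by (simp add: cq_Re_add cq_Re_complex_scale[of "h z"])
    moreover have "Re (h z) *\<^sub>R ?a + Im (h z) *\<^sub>R ?b \<in> span {?a, ?b}"
      by (intro span_add span_scale span_base) auto
    ultimately show "y \<in> ?P" by blast
  qed
qed

lemma cq_has_zero_deriv_constant:
  assumes M: "open M" "connected M" "z0 \<in> M"
    and f: "\<And>z. z \<in> M \<Longrightarrow> cq_has_deriv f 0 z" and z: "z \<in> M"
  shows "f z = f z0"
proof -
  have "g z = g z0" if "\<And>z. z \<in> M \<Longrightarrow> (g has_field_derivative 0) (at z)"
    for g :: "complex \<Rightarrow> complex"
    using has_field_derivative_0_imp_constant_on[of M g] that M z
    by (auto simp: constant_on_def)
  then show ?thesis
    using f unfolding cq_has_deriv_def cquat_eq_iff zero_cquat_def cquat.sel by auto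
qed

text \<open>The equation G'' = m G' is solved with the integrating factor exp(-P), where P' = m.
  Thus G' = exp(P) c, and a primitive h of exp(P) gives G = d + h c. Simple connectedness supplies P
  and h.\<close>

lemma cq_deriv_line_imp_planar:
  assumes M: "open M" "connected M" "simply_connected M" "M \<noteq> {}"
    and G: "cq_holomorphic_on G M" and X: "\<forall>z\<in>M. X z = cq_Re (G z)"
    and m: "m holomorphic_on M"
    and ode: "\<forall>z\<in>M. cq_deriv (cq_deriv G) z = cq_of_complex (m z) * cq_deriv G z"
    and null: "\<forall>z\<in>M. cq_dot (cq_deriv G z) (cq_deriv G z) = 0"
    and nz: "\<forall>z\<in>M. cq_deriv G z \<noteq> 0"
  shows "planar_on M X"
proof -
  have prim: "\<exists>h. \<forall>z\<in>M. (h has_field_derivative f z) (at z)" if "f holomorphic_on M" for f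
    using simply_connected_eq_global_primitive[OF M(1)] M(3) that by blast
  obtain z0 where z0: "z0 \<in> M" using M(4) by blast
  obtain P where P: "\<forall>z\<in>M. (P has_field_derivative m z) (at z)"
    using prim[OF m] by blast
  have "P holomorphic_on M"
    using P by (auto simp: holomorphic_on_open[OF M(1)])
  then have "(\<lambda>z. exp (P z)) holomorphic_on M"
    by (intro holomorphic_intros)
  then obtain h where h: "\<forall>z\<in>M. (h has_field_derivative exp (P z)) (at z)"
    using prim by blast
  have scal: "cq_has_deriv (\<lambda>w. cq_of_complex (g w)) (cq_of_complex g') z"
    if "(g has_field_derivative g') (at z)" for g g' z
    using that by (simp add: cq_has_deriv_def cq_of_complex_def)
  define c where "c = cq_of_complex (exp (- P z0)) * cq_deriv G z0"
  have c: "cq_of_complex (exp (- P z)) * cq_deriv G z = c" if "z \<in> M" for z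
    unfolding c_def
  proof (rule cq_has_zero_deriv_constant[OF M(1,2) z0 _ that])
    fix z assume z: "z \<in> M"
    have "((\<lambda>w. exp (- P w)) has_field_derivative - m z * exp (- P z)) (at z)"
      using P z by (auto intro!: derivative_eq_intros)
    from cq_has_deriv_mult[OF scal[OF this]
        cq_holomorphic_has_deriv[OF M(1) z cq_holomorphic_deriv[OF M(1) G]]]
    \<comment> \<open>The product rule gives exp(-P) (G'' - m G'), which vanishes by
      \<open>ode\<close>.\<close>
    show "cq_has_deriv (\<lambda>w. cq_of_complex (exp (- P w)) * cq_deriv G w) 0 z"
      by (rule back_subst[of "\<lambda>d. cq_has_deriv _ d z"]) (use ode z in \<open>simp add: cquat_defs\<close>)
  qed
  have G': "cq_deriv G z = cq_of_complex (exp (P z)) * c" if "z \<in> M" for z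
    unfolding c[OF that, symmetric] by (simp add: cquat_defs cquat_eq_iff exp_minus flip: mult.assoc)
  define d where "d = G z0 - cq_of_complex (h z0) * c"
  have d: "G z - cq_of_complex (h z) * c = d" if "z \<in> M" for z
    unfolding d_def
  proof (rule cq_has_zero_deriv_constant[OF M(1,2) z0 _ that])
    fix z assume z: "z \<in> M"
    have dh: "cq_has_deriv (\<lambda>w. cq_of_complex (h w) * c) (cq_deriv G z) z"
      using cq_has_deriv_mult[OF scal[OF h[rule_format, OF z]] cq_has_deriv_const, of c]
      by (simp add: G'[OF z])
    have dG: "cq_has_deriv G (cq_deriv G z) z"
      by (rule cq_holomorphic_has_deriv[OF M(1) z G])
    show "cq_has_deriv (\<lambda>w. G w - cq_of_complex (h w) * c) 0 z"
      using dh dG unfolding cq_has_deriv_def minus_cquat_def cquat.sel zero_cquat_def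
      by (auto intro!: derivative_eq_intros)
  qed
  show ?thesis
  proof (rule affine_complex_line_planar)
    show "c \<noteq> 0"
      using G'[OF z0] nz z0 by auto
    have "cq_dot (cq_deriv G z0) (cq_deriv G z0) = (exp (P z0))\<^sup>2 * cq_dot c c"
      by (simp add: G'[OF z0] cq_dot_expand cquat_defs power2_eq_square algebra_simps)
    then show "cq_dot c c = 0"
      using null z0 by simp
    show "\<forall>z\<in>M. X z = cq_Re (d + cq_of_complex (h z) * c)"
      using X d by (metis diff_add_cancel)
  qed
qed


subsection \<open>Superminimality\<close>

text \<open>If \<open>f\<close> is not identically 0, then \<open>g\<close> vanishes on the nonempty
  open set where \<open>f\<close> is nonzero, hence on all of \<open>M\<close> by the identity
  theorem.\<close>

lemma holomorphic_mult_eq_0_iff: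
  assumes M: "open M" "connected M" and f: "f holomorphic_on M" and g: "g holomorphic_on M"
  shows "(\<forall>z\<in>M. f z * g z = 0) \<longleftrightarrow> (\<forall>z\<in>M. f z = 0) \<or> (\<forall>z\<in>M. g z = 0)"
proof (rule iffI, rule ccontr)
  assume fg: "\<forall>z\<in>M. f z * g z = 0" and "\<not> ((\<forall>z\<in>M. f z = 0) \<or> (\<forall>z\<in>M. g z = 0))"
  then obtain x y where x: "x \<in> M" "f x \<noteq> 0" and y: "y \<in> M" "g y \<noteq> 0"
    by blast
  define U where "U = {z\<in>M. f z \<noteq> 0}"
  have "U = M \<inter> f -` (- {0})"
    by (auto simp: U_def)
  then have "open U"
    using continuous_open_preimage[OF holomorphic_on_imp_continuous_on[OF f] M(1), of "- {0}"]
    by (simp add: open_Compl)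
  moreover have "x \<in> U" "U \<subseteq> M" "\<And>z. z \<in> U \<Longrightarrow> g z = 0"
    using x fg by (auto simp: U_def)
  ultimately have "g y = 0"
    using analytic_continuation_open[OF _ M(1) _ M(2) _ g, of U "\<lambda>_. 0"] y(1) by auto
  with y show False by simp
qed auto

theorem theorem4p5:
  fixes M :: "complex set"
    and A B F \<alpha> \<beta> :: "complex \<Rightarrow> cquat"
    and X :: "complex \<Rightarrow> real ^ 4"
  assumes "open M" and "M \<noteq> {}" and "connected M" and "simply_connected M"
    and "cq_holomorphic_on A M" and "\<forall>z\<in>M. A z \<in> Sp1C"
    and "cq_holomorphic_on B M" and "\<forall>z\<in>M. B z \<in> Sp1C"
    and "cq_primitive_on M (\<lambda>z. A z * cqL * B z) F"
    and "\<forall>z\<in>M. X z = cq_Re (F z)"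
    and "\<forall>z\<in>M. \<alpha> z = cq_conj (A z) * cq_deriv A z"
    and "\<forall>z\<in>M. \<beta> z = cq_deriv B z * cq_conj (B z)"
  shows "conformal_minimal_immersion_on M X \<and>
    (\<forall>z\<in>M. cq_pure (\<alpha> z) \<and> cq_pure (\<beta> z)) \<and>
    (superminimal_on M X \<longleftrightarrow>
      (\<forall>z\<in>M. (cq2 (\<alpha> z) + \<i> * cq3 (\<alpha> z)) * (cq2 (\<beta> z) - \<i> * cq3 (\<beta> z)) = 0)) \<and>
    ((\<forall>z\<in>M. (cq2 (\<alpha> z) + \<i> * cq3 (\<alpha> z)) * (cq2 (\<beta> z) - \<i> * cq3 (\<beta> z)) = 0) \<longleftrightarrow>
      (\<forall>z\<in>M. cq2 (\<alpha> z) + \<i> * cq3 (\<alpha> z) = 0) \<or> (\<forall>z\<in>M. cq2 (\<beta> z) - \<i> * cq3 (\<beta> z) = 0)) \<and>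
    (superminimal_on M X \<and> \<not> planar_on M X \<longrightarrow>
      ((\<forall>z\<in>M. cq2 (\<alpha> z) + \<i> * cq3 (\<alpha> z) = 0) \<and> \<not> (\<forall>z\<in>M. cq2 (\<beta> z) - \<i> * cq3 (\<beta> z) = 0)) \<or>
      (\<not> (\<forall>z\<in>M. cq2 (\<alpha> z) + \<i> * cq3 (\<alpha> z) = 0) \<and> (\<forall>z\<in>M. cq2 (\<beta> z) - \<i> * cq3 (\<beta> z) = 0)))"
proof -
  note M = assms(1) and A = assms(5) and SA = assms(6) and B = assms(7) and SB = assms(8)
    and X = assms(10) and \<alpha> = assms(11) and \<beta> = assms(12)
  have F': "cq_deriv F z = A z * cqL * B z" if "z \<in> M" for z
    using assms(9) that by (auto simp: cq_primitive_on_def)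
  have F: "cq_holomorphic_on F M"
    using assms(9) by (simp add: cq_primitive_on_def)
  let ?Q = "\<lambda>z. \<alpha> z * cqL + cqL * \<beta> z"
  have F'': "cq_deriv (cq_deriv F) z = A z * ?Q z * B z" if z: "z \<in> M" for z
  proof -
    have "cq_has_deriv (\<lambda>w. A w * cqL * B w)
        ((cq_deriv A z * cqL + A z * 0) * B z + A z * cqL * cq_deriv B z) z"
      by (intro cq_has_deriv_mult cq_has_deriv_const cq_holomorphic_has_deriv[OF M z] A B)
    from cq_has_deriv_imp_deriv[OF cq_has_deriv_transform[OF M z this, of "cq_deriv F"]]
    have "cq_deriv (cq_deriv F) z = cq_deriv A z * cqL * B z + A z * cqL * cq_deriv B z"
      by (simp add: F')
    \<comment> \<open>Inverting the definitions of \<alpha> and \<beta> by A A^c = 1 and B^c B = 1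
      lets \<open>A\<close> and \<open>B\<close> be factored out on the two sides.\<close>
    moreover have "cq_deriv A z = A z * \<alpha> z" "cq_deriv B z = \<beta> z * B z"
      using z SA SB \<alpha> \<beta>
      by (simp_all add: Sp1C_conj_right Sp1C_conj_left mult.assoc flip: mult.assoc[of "A z"])
    ultimately show ?thesis
      by (simp add: algebra_simps)
  qed
  have pure: "cq_pure (\<alpha> z)" "cq_pure (\<beta> z)" if "z \<in> M" for z
    using Sp1C_deriv_pure[OF M that] A B SA SB \<alpha> \<beta> that by auto
  have null: "cq_dot (cq_deriv F z) (cq_deriv F z) = 0" and nz: "cq_deriv F z \<noteq> 0"
    and orth: "cq_dot (cq_deriv F z) (cq_deriv (cq_deriv F) z) = 0"
    and sq: "cq_dot (cq_deriv (cq_deriv F) z) (cq_deriv (cq_deriv F) z)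
      = 4 * ((cq2 (\<alpha> z) + \<i> * cq3 (\<alpha> z)) * (cq2 (\<beta> z) - \<i> * cq3 (\<beta> z)))" if z: "z \<in> M" for z
    \<comment> \<open>The outer factors \<open>A z\<close> and \<open>B z\<close> drop out by
      invariance, leaving identities about \<open>cqL\<close>.\<close>
    using z SA SB cqL_nonzero cq_dot_cqL_pure[OF pure[OF z]] cq_dot_self_pure_cqL[OF pure[OF z]]
    by (simp_all add: F' F'' cq_dot_Sp1C_invariant cq_dot_cqL Sp1C_sandwich_eq_0_iff)
  have cmi: "conformal_minimal_immersion_on M X"
    using null_conformal_minimal[OF M F X] null nz by blast
  have super: "superminimal_on M X \<longleftrightarrow>
      (\<forall>z\<in>M. (cq2 (\<alpha> z) + \<i> * cq3 (\<alpha> z)) * (cq2 (\<beta> z) - \<i> * cq3 (\<beta> z)) = 0)"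
    using cmi by (simp add: superminimal_on_def sq
        null_curvature_ellipse_circle_iff[OF M _ F X null nz orth])
  have "cq_holomorphic_on (\<lambda>z. cq_conj (A z) * cq_deriv A z) M"
    "cq_holomorphic_on (\<lambda>z. cq_deriv B z * cq_conj (B z)) M"
    by (intro cq_holomorphic_mult cq_holomorphic_conj cq_holomorphic_deriv M A B)+
  then have hol: "cq_holomorphic_on \<alpha> M" "cq_holomorphic_on \<beta> M"
    using \<alpha> \<beta> by (auto simp: cq_holomorphic_on_def cong: holomorphic_cong)
  have dich: "(\<forall>z\<in>M. (cq2 (\<alpha> z) + \<i> * cq3 (\<alpha> z)) * (cq2 (\<beta> z) - \<i> * cq3 (\<beta> z)) = 0) \<longleftrightarrow>
      (\<forall>z\<in>M. cq2 (\<alpha> z) + \<i> * cq3 (\<alpha> z) = 0) \<or> (\<forall>z\<in>M. cq2 (\<beta> z) - \<i> * cq3 (\<beta> z) = 0)"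
    by (rule holomorphic_mult_eq_0_iff[OF M assms(3)])
      (use hol in \<open>auto simp: cq_holomorphic_on_def intro!: holomorphic_intros\<close>)
  have planar: "planar_on M X"
    if a: "\<forall>z\<in>M. cq2 (\<alpha> z) + \<i> * cq3 (\<alpha> z) = 0" and b: "\<forall>z\<in>M. cq2 (\<beta> z) - \<i> * cq3 (\<beta> z) = 0"
  proof (rule cq_deriv_line_imp_planar[OF M assms(3,4,2) F X])
    let ?m = "\<lambda>z. - \<i> * (cq1 (\<alpha> z) + cq1 (\<beta> z))"
    show "?m holomorphic_on M"
      using hol by (auto simp: cq_holomorphic_on_def intro!: holomorphic_intros)
    show "\<forall>z\<in>M. cq_deriv (cq_deriv F) z = cq_of_complex (?m z) * cq_deriv F z"
    proof
      fix z assume z: "z \<in> M"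
      have "?Q z = cq_of_complex (?m z) * cqL"
        using pure_cqL_proportional[OF pure[OF z]] a b z by blast
      then show "cq_deriv (cq_deriv F) z = cq_of_complex (?m z) * cq_deriv F z"
        unfolding F''[OF z] F'[OF z] by (metis cq_of_complex_commute mult.assoc)
    qed
  qed (use null nz in auto)
  \<comment> \<open>If both alternatives held, \<open>planar\<close> would apply; this excludes the
    overlap in the non-planar case.\<close>
  show ?thesis
    using cmi pure super dich planar by blast
qed

end
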